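(* Let $G$ be a finitely generated contracting self-similar group and $S\subseteq G$ a finite generating set closed under restrictions. Then the history graph of the VERS $\mathcal R(G,S)$ coincides with the self-similarity graph $\Sigma(G,S)$: both have vertex set $X^*$ and vertical edges $w\to xw$ ($w\in X^*$, $x\in X$), and for all $n\ge0$, $u,v\in X^n$ and $g\in S$, the history graph has a $g$-colored horizontal edge $u\to v$ if and only if $g(u)=v$.
   Context: Let $X=\{0,1,\dots,d-1\}$, $X^*$ the finite words over $X$, $\varepsilon$ the empty word. A self-similar group is a group $G$ of permutations of $X^*$ such that for every $g\in G$ and $x\in X$ there are $h\in G$, $y\in X$ with $g(xw)=y\,h(w)$ for all $w\in X^*$; write $\sigma_g(x)=y$ and $g_x=h$, and $g_{xw}=(g_x)_w$. $G$ is contracting if there is a finite $N\subseteq G$ such that for each $g\in G$ there is $k$ with $g_w\in N$ for all words $w$ of length $\ge k$. $S$ is closed under restrictions if $g_x\in S$ for all $g\in S$, $x\in X$. The VERS $\mathcal R(G,S)$ produces graphs $\Gamma_n$ with vertex set $X^n$ and edges colored by $S$: $\Gamma_0$ is the vertex $\varepsilon$ with one $g$-colored loop for each $g\in S$; $\Gamma_{n+1}$ has, for every $g'$-colored edge $u\to v$ of $\Gamma_n$ and all $x,y\in X$, $h\in S$ with $\sigma_h(x)=y$ and $h_x=g'$, an $h$-colored edge $xu\to yv$, and no other edges. Its history graph has vertex set $X^*$, vertical edges $w\to xw$, and horizontal edges all edges of all $\Gamma_n$ (with their colors). The self-similarity graph $\Sigma(G,S)$ has vertex set $X^*$, vertical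 edges $w\to xw$ for $w\in X^*$, $x\in X$, and a horizontal edge $u\to g(u)$ labeled $g$ for each $u\in X^*$ and $g\in S$. *)

theory Defs
  imports "HOL-Algebra.Bij" "HOL-Algebra.Generated_Groups"
begin

type_synonym word = "nat list"

abbreviation words :: "nat \<Rightarrow> word set" where
  "words d \<equiv> lists {..<d}"

definition words_of_length :: "nat \<Rightarrow> nat \<Rightarrow> word set" where
  "words_of_length d n = {w \<in> words d. length w = n}"

text \<open>Permutations of the set of words are elements of \<^term>\<open>BijGroup (words d)\<close>, hence they are
  \<^const>\<open>extensional\<close>: two of them are equal iff they agree on all words over the alphabet.\<close>

definition splits_as ::
  "nat \<Rightarrow> (word \<Rightarrow> word) \<Rightarrow> nat \<Rightarrow> nat \<Rightarrow> (word \<Rightarrow> word) \<Rightarrow> bool" where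
  "splits_as d g x y h \<longleftrightarrow> (\<forall>w \<in> words d. g (x # w) = y # h w)"

definition self_similar_group :: "nat \<Rightarrow> (word \<Rightarrow> word) set \<Rightarrow> bool" where
  "self_similar_group d G \<longleftrightarrow>
     subgroup G (BijGroup (words d)) \<and>
     (\<forall>g \<in> G. \<forall>x \<in> {..<d}. \<exists>h \<in> G. \<exists>y \<in> {..<d}. splits_as d g x y h)"

text \<open>The letter \<open>\<sigma>\<^sub>g(x)\<close> and the restriction \<open>g\<^sub>x\<close>. The lemma \<open>splits_as_iff\<close> below shows that the
  descriptions are proper.\<close>

definition sigma :: "nat \<Rightarrow> (word \<Rightarrow> word) set \<Rightarrow> (word \<Rightarrow> word) \<Rightarrow> nat \<Rightarrow> nat" where
  "sigma d G g x = (THE y. y \<in> {..<d} \<and> (\<exists>h \<in> G. splits_as d g x y h))"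

definition restr ::
  "nat \<Rightarrow> (word \<Rightarrow> word) set \<Rightarrow> (word \<Rightarrow> word) \<Rightarrow> nat \<Rightarrow> (word \<Rightarrow> word)" where
  "restr d G g x = (THE h. h \<in> G \<and> (\<exists>y \<in> {..<d}. splits_as d g x y h))"

primrec restr_word ::
  "nat \<Rightarrow> (word \<Rightarrow> word) set \<Rightarrow> (word \<Rightarrow> word) \<Rightarrow> word \<Rightarrow> (word \<Rightarrow> word)" where
  "restr_word d G g [] = g"
| "restr_word d G g (x # w) = restr_word d G (restr d G g x) w"

definition contracting :: "nat \<Rightarrow> (word \<Rightarrow> word) set \<Rightarrow> bool" where
  "contracting d G \<longleftrightarrow>
     (\<exists>N. N \<subseteq> G \<and> finite N \<and>
        (\<forall>g \<in> G. \<exists>k. \<forall>w \<in> words d. length w \<ge> k \<longrightarrow> restr_word d G g w \<in> N))"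

definition closed_under_restrictions ::
  "nat \<Rightarrow> (word \<Rightarrow> word) set \<Rightarrow> (word \<Rightarrow> word) set \<Rightarrow> bool" where
  "closed_under_restrictions d G S \<longleftrightarrow> (\<forall>g \<in> S. \<forall>x \<in> {..<d}. restr d G g x \<in> S)"

lemma splits_as_unique:
  assumes "G \<subseteq> extensional (words d)" "h \<in> G" "h' \<in> G"
    and "splits_as d g x y h" "splits_as d g x y' h'"
  shows "y = y'" "h = h'"
proof -
  have *: "y # h w = y' # h' w" if "w \<in> words d" for w
    using assms(4,5) that unfolding splits_as_def by metis
  from *[of "[]"] show "y = y'" by simp
  show "h = h'"
    using assms(1-3) * by (intro extensionalityI[of h "words d" h']) auto
qed

lemma splits_as_iff:
  assumes G: "self_similar_group d G" and g: "g \<in> G" and x: "x \<in> {..<d}"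
  shows "h \<in> G \<and> y \<in> {..<d} \<and> splits_as d g x y h \<longleftrightarrow> sigma d G g x = y \<and> restr d G g x = h"
proof -
  have ext: "G \<subseteq> extensional (words d)"
    using G subgroup.subset[of G "BijGroup (words d)"]
    by (auto simp: self_similar_group_def BijGroup_def Bij_def)
  obtain h0 y0 where 0: "h0 \<in> G" "y0 \<in> {..<d}" "splits_as d g x y0 h0"
    using G g x unfolding self_similar_group_def by blast
  have "sigma d G g x = y0"
    unfolding sigma_def using 0 splits_as_unique[OF ext] by (intro the_equality) blast+
  moreover have "restr d G g x = h0"
    unfolding restr_def using 0 splits_as_unique[OF ext] by (intro the_equality) blast+
  ultimately show ?thesis
    using 0 splits_as_unique[OF ext] by blast
qed

text \<open>A coloured directed edge is a triple (source, colour, target).\<close>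

record 'c colored_graph =
  vertices :: "word set"
  edges :: "(word \<times> 'c \<times> word) set"

record 'c layered_graph =
  lverts :: "word set"
  vertical :: "(word \<times> word) set"
  horizontal :: "(word \<times> 'c \<times> word) set"

primrec vers_edges ::
  "nat \<Rightarrow> (word \<Rightarrow> word) set \<Rightarrow> (word \<Rightarrow> word) set \<Rightarrow> nat \<Rightarrow> (word \<times> (word \<Rightarrow> word) \<times> word) set" where
  "vers_edges d G S 0 = {([], g, []) | g. g \<in> S}"
| "vers_edges d G S (Suc n) =
     {(x # u, h, y # v) | x y u v h g'.
        (u, g', v) \<in> vers_edges d G S n \<and> x \<in> {..<d} \<and> y \<in> {..<d} \<and> h \<in> S \<and>
        sigma d G h x = y \<and> restr d G h x = g'}"

text \<open>The sequence of graphs produced by the vertex-edge replacement system of \<open>(G, S)\<close>.\<close>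

definition vers_graph ::
  "nat \<Rightarrow> (word \<Rightarrow> word) set \<Rightarrow> (word \<Rightarrow> word) set \<Rightarrow> nat \<Rightarrow> (word \<Rightarrow> word) colored_graph" where
  "vers_graph d G S n = \<lparr>vertices = words_of_length d n, edges = vers_edges d G S n\<rparr>"

definition vertical_edges :: "nat \<Rightarrow> (word \<times> word) set" where
  "vertical_edges d = {(w, x # w) | w x. w \<in> words d \<and> x \<in> {..<d}}"

definition history_graph :: "nat \<Rightarrow> (nat \<Rightarrow> 'c colored_graph) \<Rightarrow> 'c layered_graph" where
  "history_graph d \<Gamma> =
     \<lparr>lverts = words d, vertical = vertical_edges d, horizontal = (\<Union>n. edges (\<Gamma> n))\<rparr>"

definition self_similarity_graph ::
  "nat \<Rightarrow> (word \<Rightarrow> word) set \<Rightarrow> (word \<Rightarrow> word) layered_graph" where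
  "self_similarity_graph d S =
     \<lparr>lverts = words d, vertical = vertical_edges d,
      horizontal = {(u, g, g u) | u g. u \<in> words d \<and> g \<in> S}\<rparr>"

end

theory Submission
  imports Defs
begin

text \<open>An edge of \<open>\<Gamma>\<^sub>n\<^sub>+\<^sub>1\<close> labelled \<open>h\<close> and starting in \<open>xu\<close> comes from an edge \<open>u \<rightarrow> v\<close> of \<open>\<Gamma>\<^sub>n\<close> labelled
  \<open>h\<^sub>x\<close> and ends in \<open>\<sigma>\<^sub>h(x)v\<close>. If \<open>v = h\<^sub>x(u)\<close>, this end is \<open>h(xu)\<close>, and every \<open>h\<^sub>x\<close> is available as a
  label because \<open>S\<close> is closed under restrictions. So induction on \<open>n\<close> identifies the
  edges of \<open>\<Gamma>\<^sub>n\<close> with the action of \<open>S\<close> on \<open>X\<^sup>n\<close>.\<close>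

lemma self_similar_group_bij_betw:
  assumes "self_similar_group d G" and "g \<in> G"
  shows "bij_betw g (words d) (words d)"
  using assms subgroup.subset[of G "BijGroup (words d)"]
  by (auto simp: self_similar_group_def BijGroup_def Bij_def)

text \<open>For \<open>restr\<close> and \<open>sigma\<close> themselves the right side of
  \<open>splits_as_iff\<close> is trivially true, so its left side yields all three facts.\<close>

lemma self_similar_group_Cons:
  assumes "self_similar_group d G" and "g \<in> G" and "x \<in> {..<d}"
  shows "restr d G g x \<in> G" and "sigma d G g x \<in> {..<d}"
    and "w \<in> words d \<Longrightarrow> g (x # w) = sigma d G g x # restr d G g x w"
  using splits_as_iff[OF assms, of "restr d G g x" "sigma d G g x"]
  by (auto simp: splits_as_def)

text \<open>The value at \<open>\<epsilon>\<close> is not part of the splitting condition: it is forced because nonempty words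
  have nonempty images while \<open>g\<close> is onto.\<close>

lemma self_similar_group_Nil:
  assumes G: "self_similar_group d G" and g: "g \<in> G"
  shows "g [] = []"
proof -
  have "[] \<in> g ` words d"
    using self_similar_group_bij_betw[OF G g] by (simp add: bij_betw_def)
  then obtain w where w: "w \<in> words d" "g w = []" by (metis imageE)
  have "w = []"
  proof (cases w)
    case (Cons x w')
    with w self_similar_group_Cons(3)[OF G g, of x w'] show ?thesis by auto
  qed
  with w show ?thesis by simp
qed

lemma words_of_length_0: "words_of_length d 0 = {[]}"
  by (auto simp: words_of_length_def)

lemma Cons_in_words_of_length_Suc:
  "x # u \<in> words_of_length d (Suc n) \<longleftrightarrow> x \<in> {..<d} \<and> u \<in> words_of_length d n"
  by (auto simp: words_of_length_def)

lemma vers_edges_iff: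
  assumes G: "self_similar_group d G" and S: "S \<subseteq> G"
    and closed: "closed_under_restrictions d G S"
  shows "(u, g, v) \<in> vers_edges d G S n \<longleftrightarrow> u \<in> words_of_length d n \<and> g \<in> S \<and> v = g u"
proof (induction n arbitrary: u g v)
  case 0
  then show ?case
    using self_similar_group_Nil[OF G, of g] S by (auto simp: words_of_length_0)
next
  case (Suc n)
  show ?case
  proof (cases u)
    case Nil
    then show ?thesis by (auto simp: words_of_length_def)
  next
    case (Cons x w)
    have "(u, g, v) \<in> vers_edges d G S (Suc n) \<longleftrightarrow>
        x \<in> {..<d} \<and> sigma d G g x \<in> {..<d} \<and> g \<in> S \<and>
        (\<exists>v'. (w, restr d G g x, v') \<in> vers_edges d G S n \<and> v = sigma d G g x # v')"
      using Cons by auto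
    \<comment> \<open>Self-similarity discharges the range condition on \<open>sigma\<close>; the
      induction hypothesis forces \<open>v'\<close> to be \<open>restr d G g x w\<close>.\<close>
    also have "\<dots> \<longleftrightarrow> x \<in> {..<d} \<and> g \<in> S \<and> w \<in> words_of_length d n \<and>
        v = sigma d G g x # restr d G g x w"
      using closed self_similar_group_Cons(2)[OF G, of g x] S
      by (auto simp: Suc.IH closed_under_restrictions_def)
    also have "\<dots> \<longleftrightarrow> u \<in> words_of_length d (Suc n) \<and> g \<in> S \<and> v = g u"
    proof -
      have "g (x # w) = sigma d G g x # restr d G g x w"
        if "g \<in> S" "x \<in> {..<d}" "w \<in> words_of_length d n"
        using that S self_similar_group_Cons(3)[OF G, of g x w]
        unfolding words_of_length_def by blast
      then show ?thesis
        unfolding Cons Cons_in_words_of_length_Suc by auto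
    qed
    finally show ?thesis .
  qed
qed

theorem theorem4p3:
  fixes d :: nat and G S :: "(word \<Rightarrow> word) set"
  assumes "self_similar_group d G"
    and "contracting d G"
    and "S \<subseteq> G" and "finite S" and "generate (BijGroup (words d)) S = G"
    and "closed_under_restrictions d G S"
  shows "history_graph d (vers_graph d G S) = self_similarity_graph d S
    \<and> lverts (history_graph d (vers_graph d G S)) = words d
    \<and> vertical (history_graph d (vers_graph d G S)) = {(w, x # w) | w x. w \<in> words d \<and> x \<in> {..<d}}
    \<and> (\<forall>n. \<forall>u \<in> words_of_length d n. \<forall>v \<in> words_of_length d n. \<forall>g \<in> S.
         (u, g, v) \<in> horizontal (history_graph d (vers_graph d G S)) \<longleftrightarrow> g u = v)"
proof -
  \<comment> \<open>Every word lies on the level given by its length, so the union over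
    \<open>n\<close> drops the length condition.\<close>
  have "(\<Union>n. vers_edges d G S n) = {(u, g, g u) | u g. u \<in> words d \<and> g \<in> S}"
    using vers_edges_iff[OF assms(1,3,6)] by (auto simp: words_of_length_def)
  then show ?thesis
    by (auto simp: history_graph_def vers_graph_def self_similarity_graph_def
        vertical_edges_def words_of_length_def)
qed

end
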